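(* Let $m\ge1$, $n=2m$, $q=2^m$, $\mathbb{K}=\mathbb{F}_q\subset\mathbb{F}=\mathbb{F}_{q^2}$, $C\in\mathbb{F}$ and $1\le k<n$. The polynomial $P_{C,k}(X)=X^{2^k+1}+CX^{2^k}+C^qX+1$ has no solution $X\in\mathcal{P}_{q-1}$ if and only if all three of the following hold: (1) $k\ne m$; (2) $C\notin\mathbb{K}$; (3) writing $C^q+1=bh$ with $b\in\mathbb{K}^*$ and $h\in\mathcal{T}_1$, one has $h\notin Z_{k,1}$ and $$\frac{\mathrm{Tr}(h^3)+1+\frac1b}{\mathrm{Tr}(h^{2^k+1})^{2^{n-k}+1}}\notin\mathrm{Im}(\Gamma_k).$$
   Context: $\mathrm{Tr}(X)=X+X^q$; $\mathcal{T}_1=\{X\in\mathbb{F}:\mathrm{Tr}(X)=1\}$; $\mathcal{P}_{q-1}=\{X^{q-1}:X\in\mathbb{F}^*\}$ (the subgroup of $\mathbb{F}^*$ of order $q+1$); $Z_{k,1}=\{g\in\mathcal{T}_1:g^{2^k}+g=1\}$; $\Gamma_k:\mathbb{K}\to\mathbb{K}$, $\Gamma_k(x)=x^{2^k+1}+x$. If $C\notin\mathbb{K}$ then $C^q+1\notin\mathbb{K}$ and it has a unique representation $C^q+1=bh$ with $b\in\mathbb{K}^*$, $h\in\mathcal{T}_1$. *)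

theory Defs
  imports "HOL-Library.Cardinality" "HOL-Number_Theory.Number_Theory" "HOL-Computational_Algebra.Polynomial"
begin

definition is_subfield :: "'a::field set \<Rightarrow> bool" where
  "is_subfield S \<longleftrightarrow> 0 \<in> S \<and> 1 \<in> S \<and>
     (\<forall>x\<in>S. \<forall>y\<in>S. x - y \<in> S \<and> x * y \<in> S) \<and> (\<forall>x\<in>S. inverse x \<in> S)"

definition Tr :: "nat \<Rightarrow> 'a::field \<Rightarrow> 'a" where
  "Tr q x = x + x ^ q"

definition trace_one :: "nat \<Rightarrow> 'a::field set" where
  "trace_one q = {x. Tr q x = 1}"

definition nonzero_powers :: "nat \<Rightarrow> 'a::field set" where
  "nonzero_powers r = (\<lambda>x. x ^ r) ` (UNIV - {0})"

definition Z1 :: "nat \<Rightarrow> nat \<Rightarrow> 'a::field set" where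
  "Z1 q k = {g \<in> trace_one q. g ^ (2 ^ k) + g = 1}"

definition Gamma_map :: "nat \<Rightarrow> 'a::field \<Rightarrow> 'a" where
  "Gamma_map k x = x ^ (2 ^ k + 1) + x"

definition P_poly :: "nat \<Rightarrow> nat \<Rightarrow> 'a::field \<Rightarrow> 'a poly" where
  "P_poly q k C = monom 1 (2 ^ k + 1) + monom C (2 ^ k) + monom (C ^ q) 1 + 1"

lemma char_2:
  assumes "CARD('a::finite_field) = q\<^sup>2" "q = 2 ^ m"
  shows "CHAR('a) = 2"
proof -
  have "CHAR('a) dvd 2 ^ (m * 2)"
    using CHAR_dvd_CARD[where 'a = 'a] assms by (simp add: power_mult)
  hence "CHAR('a) dvd 2"
    using prime_dvd_power[OF CHAR_prime[where 'a = 'a]] by blast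
  thus ?thesis
    using primes_dvd_imp_eq[OF CHAR_prime[where 'a = 'a] two_is_prime_nat] by simp
qed

lemma add_self_0:
  fixes x :: "'a::finite_field"
  assumes "CARD('a) = q\<^sup>2" "q = 2 ^ m"
  shows "x + x = 0"
proof -
  have "(2 :: 'a) = 0"
    using of_nat_CHAR[where 'a = 'a] char_2[OF assms] by simp
  thus ?thesis by (metis mult_2 mult_zero_left)
qed

lemma frobenius_add:
  fixes x y :: "'a::finite_field"
  assumes "CARD('a) = q\<^sup>2" "q = 2 ^ m"
  shows "(x + y) ^ q = x ^ q + y ^ q"
  using freshmans_dream'[OF CHAR_prime[where 'a = 'a], of q m] char_2[OF assms] assms(2) by simp

lemma minus_is_plus:
  fixes x y :: "'a::finite_field"
  assumes "CARD('a) = q\<^sup>2" "q = 2 ^ m"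
  shows "x - y = x + y"
proof -
  have "- y = y" using add_self_0[OF assms, of y] by (simp add: neg_eq_iff_add_eq_0)
  thus ?thesis by (metis diff_conv_add_uminus)
qed

lemma is_subfield_fixed:
  assumes "CARD('a::finite_field) = q\<^sup>2" "q = 2 ^ m"
  shows "is_subfield {x::'a. x ^ q = x}"
proof -
  have "q > 0" using assms(2) by simp
  thus ?thesis
    unfolding is_subfield_def
    by (auto simp: minus_is_plus[OF assms] frobenius_add[OF assms] power_mult_distrib power_inverse)
qed

lemma card_fixed:
  assumes card: "CARD('a::finite_field) = q\<^sup>2" "q = 2 ^ m" and m: "m \<ge> 1"
  shows "card {x::'a. x ^ q = x} = q"
proof (rule antisym)
  let ?F = "{x::'a. x ^ q = x}"
  have q: "q \<ge> 2" using m card(2) power_increasing[of 1 m "2::nat"] by simp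
  define p :: "'a poly" where "p = monom 1 q - monom 1 1"
  have "coeff p q = 1" using q by (simp add: p_def)
  hence p: "p \<noteq> 0" by auto
  have "degree p \<le> q" using q unfolding p_def
    by (intro degree_diff_le) (auto intro: order.trans[OF degree_monom_le])
  moreover have "?F = {x. poly p x = 0}" by (auto simp: p_def poly_monom)
  ultimately show le: "card ?F \<le> q"
    using card_poly_roots_bound[OF p] by simp
  define R where "R = range (Tr q :: 'a \<Rightarrow> 'a)"
  have "R \<subseteq> ?F"
  proof
    fix y assume "y \<in> R"
    then obtain x where y: "y = x + x ^ q" by (auto simp: R_def Tr_def)
    have "(x ^ q) ^ q = x"
      using finite_field_power_card_eq_same[of x] card(1)
      by (simp add: power_mult[symmetric] power2_eq_square)
    thus "y \<in> ?F" by (simp add: y frobenius_add[OF card] add.commute)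
  qed
  hence R: "card R \<le> card ?F" by (intro card_mono) auto
  have fib: "card {x. Tr q x = y} \<le> card ?F" for y :: 'a
  proof (cases "\<exists>x0. Tr q x0 = y")
    case True
    then obtain x0 where x0: "Tr q x0 = y" by blast
    have "(\<lambda>x. x + x0) ` {x. Tr q x = y} \<subseteq> ?F"
    proof clarify
      fix x assume "y = Tr q x"
      hence "x + x ^ q = x0 + x0 ^ q" using x0 by (simp add: Tr_def)
      hence "x ^ q - x0 ^ q = x0 - x" by (simp add: algebra_simps)
      hence "x ^ q + x0 ^ q = x + x0" unfolding minus_is_plus[OF card] by (simp add: add.commute)
      thus "(x + x0) ^ q = x + x0" by (simp add: frobenius_add[OF card])
    qed
    hence "card ((\<lambda>x. x + x0) ` {x. Tr q x = y}) \<le> card ?F" by (intro card_mono) auto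
    thus ?thesis by (simp add: card_image)
  qed simp
  have "q\<^sup>2 = card (\<Union>y\<in>R. {x. Tr q x = y})"
    unfolding card(1)[symmetric] by (rule arg_cong[of _ _ card]) (auto simp: R_def)
  also have "\<dots> \<le> (\<Sum>y\<in>R. card {x. Tr q x = y})" by (rule card_UN_le) simp
  also have "\<dots> \<le> card R * card ?F" using sum_bounded_above[of R, OF fib] by simp
  also have "\<dots> \<le> (card ?F)\<^sup>2" using R by (simp add: power2_eq_square)
  finally show "q \<le> card ?F" using power2_le_imp_le by blast
qed

text \<open>The subfield with \<open>q\<close> elements exists and is unique.\<close>

lemma is_subfield_card_iff:
  assumes card: "CARD('a::finite_field) = q\<^sup>2" "q = 2 ^ m" and m: "m \<ge> 1"
  shows "is_subfield S \<and> card S = q \<longleftrightarrow> S = {x::'a. x ^ q = x}"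
proof
  assume "S = {x. x ^ q = x}"
  thus "is_subfield S \<and> card S = q"
    using is_subfield_fixed[OF card] card_fixed[OF assms] by simp
next
  assume S: "is_subfield S \<and> card S = q"
  have "x ^ q = x" if x: "x \<in> S" for x
  proof (cases "x = 0")
    case False
    have "(\<lambda>y. x * y) ` (S - {0}) = S - {0}"
      using S x False
      by (intro card_subset_eq) (auto simp: is_subfield_def card_image inj_on_def)
    hence "prod (\<lambda>y. y) (S - {0}) = (\<Prod>y\<in>S - {0}. x * y)"
      using prod.reindex[of "\<lambda>y. x * y" "S - {0}" "\<lambda>y. y"] False by (simp add: inj_on_def)
    also have "\<dots> = x ^ card (S - {0}) * prod (\<lambda>y. y) (S - {0})"
      by (simp add: prod.distrib)
    finally have "x ^ card (S - {0}) = 1"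
      by (simp add: prod_zero_iff)
    moreover have "card (S - {0}) = q - 1" using S by (simp add: is_subfield_def)
    moreover have "x ^ q = x ^ (q - 1) * x"
      using card(2) by (metis power_minus_mult zero_less_power zero_less_numeral)
    ultimately show ?thesis by simp
  qed (use card(2) in simp)
  hence "S \<subseteq> {x. x ^ q = x}" by blast
  thus "S = {x. x ^ q = x}"
    using S card_fixed[OF assms] by (intro card_subset_eq) auto
qed

text \<open>By uniqueness of this representation, it makes no difference whether the pair \<open>(b, h)\<close> is quantified existentially or
  universally. The denominators \<open>b\<close> and \<open>Tr q (h ^ (2 ^ k + 1))\<close> do not vanish for
  \<open>h \<notin> Z1 q k\<close>: for \<open>h\<close> of trace one the latter is \<open>h ^ (2 ^ k) + h + 1\<close>.\<close>

lemma unique_representation: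
  fixes C :: "'a::finite_field"
  assumes card: "CARD('a) = q\<^sup>2" "q = 2 ^ m" and m: "m \<ge> 1"
    and K: "is_subfield K" "card K = q" and C: "C \<notin> K"
  shows "\<exists>!(b, h). b \<in> K - {0} \<and> h \<in> trace_one q \<and> C ^ q + 1 = b * h"
proof -
  have Keq: "K = {x. x ^ q = x}" using is_subfield_card_iff[OF card m] K by blast
  define D where "D = C ^ q + 1"
  have Cqq: "(C ^ q) ^ q = C"
    using finite_field_power_card_eq_same[of C] card(1)
    by (simp add: power_mult[symmetric] power2_eq_square)
  have D: "D ^ q = C + 1" by (simp add: D_def frobenius_add[OF card] Cqq)
  have b: "Tr q D = C ^ q + C"
    using add_self_0[OF card, of "1::'a"] unfolding Tr_def D unfolding D_def
    by (simp add: add.assoc add.left_commute[of 1])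
  have b0: "Tr q D \<noteq> 0"
    using C unfolding b Keq minus_is_plus[OF card, symmetric] by simp
  have bK: "Tr q D \<in> K" unfolding b Keq by (simp add: frobenius_add[OF card] Cqq add.commute)
  have "Tr q (D / Tr q D) = Tr q D / Tr q D"
    using bK unfolding Keq by (simp add: Tr_def[of q "D / _"] power_divide add_divide_distrib[symmetric])
      (simp add: Tr_def)
  hence h: "D / Tr q D \<in> trace_one q" using b0 by (simp add: trace_one_def)
  show ?thesis
  proof (rule ex1I[of _ "(Tr q D, D / Tr q D)"], unfold case_prod_conv)
    show "Tr q D \<in> K - {0} \<and> D / Tr q D \<in> trace_one q \<and> C ^ q + 1 = Tr q D * (D / Tr q D)"
      using bK b0 h by (simp add: D_def)
  next
    fix z :: "'a \<times> 'a"
    assume "case z of (b, h) \<Rightarrow> b \<in> K - {0} \<and> h \<in> trace_one q \<and> C ^ q + 1 = b * h"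
    then obtain b h where z: "z = (b, h)" "b \<in> K" "b \<noteq> 0" "Tr q h = 1" "D = b * h"
      by (auto simp: trace_one_def D_def)
    have "Tr q D = b * Tr q h"
      using z(2) unfolding z(5) Keq by (simp add: Tr_def power_mult_distrib distrib_left)
    hence "Tr q D = b" using z(4) by simp
    thus "z = (Tr q D, D / Tr q D)" using z by simp
  qed
qed

end

theory Submission
  imports Defs
begin

text \<open>Since \<open>X = 1\<close> is a root exactly when \<open>C \<in> K\<close>, assume \<open>C \<notin> K\<close>. The map \<open>g \<mapsto> (g + 1) / g = g\<^sup>q / g\<close>
  is a bijection from the elements of trace one onto \<open>\<P> - {1}\<close>, where \<open>\<P>\<close> is the group of
  \<open>(q - 1)\<close>-st powers, and \<open>y \<mapsto> h + y\<close> is one from \<open>K\<close> onto the elements of trace one.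
  In the variable \<open>y\<close> the equation becomes
  \<open>y ^ (2 ^ k + 1) + t * y + (h\<^sup>2 + h + 1 / b) = 0\<close> over \<open>K\<close> with \<open>t = h ^ (2 ^ k) + h + 1\<close>.
  If \<open>t \<noteq> 0\<close>, scaling \<open>y\<close> by the \<open>2 ^ k\<close>-th root \<open>t ^ (2 ^ (n - k))\<close> of \<open>t\<close> turns it into the
  condition on \<open>\<Gamma>\<^sub>k\<close>. If \<open>t = 0\<close>, both the \<open>2 ^ k\<close>- and the \<open>2 ^ m\<close>-power Frobenius map send \<open>h\<close> to
  \<open>h + 1\<close>, which forces \<open>k\<close> and \<open>m\<close> to have the same \<open>2\<close>-adic valuation; then
  \<open>2 ^ k + 1\<close> is coprime to \<open>q - 1\<close> and the equation is solvable.\<close>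

locale binary_quadratic_extension =
  fixes K :: "'a::finite_field set" and m q :: nat
  assumes m_pos: "m \<ge> 1" and q_def: "q = 2 ^ m" and card_UNIV: "CARD('a) = q\<^sup>2"
    and K_eq: "K = {x. x ^ q = x}"
begin

section \<open>Frobenius powers, trace-one elements and \<open>(q - 1)\<close>-st powers\<close>

lemma power_power_commute: "(x ^ i) ^ j = ((x::'a) ^ j) ^ i"
  by (simp add: power_mult[symmetric] mult.commute)

lemma add_self [simp]: "x + x = (0::'a)"
  by (rule add_self_0[OF card_UNIV q_def])

lemma add_self_left [simp]: "x + (x + y) = (y::'a)"
  by (simp add: add.assoc[symmetric])

lemma two_eq_zero: "(2::'a) = 0"
  using add_self[of 1] unfolding one_add_one .

lemma add_eq_0_iff_eq: "x + y = 0 \<longleftrightarrow> x = (y::'a)"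
  by (metis add_self add_self_left add_0_right)

lemma power_two_power_add: "(x + y) ^ (2 ^ i) = x ^ (2 ^ i) + (y::'a) ^ (2 ^ i)"
  using freshmans_dream'[OF CHAR_prime[where 'a = 'a], of "2 ^ i" i]
    char_2[OF card_UNIV q_def] by simp

lemma power_q_add: "(x + y) ^ q = x ^ q + (y::'a) ^ q"
  by (simp add: q_def power_two_power_add)

lemma power_q_power_q [simp]: "(x ^ q) ^ q = (x::'a)"
  using finite_field_power_card_eq_same[of x] card_UNIV
  by (simp add: power_mult[symmetric] power2_eq_square)

lemma power_two_power_2m: "x ^ (2 ^ (2 * m)) = (x::'a)"
  using finite_field_power_card_eq_same[of x] card_UNIV q_def
  by (simp add: power_mult[symmetric] mult.commute)

lemma q_pos: "0 < q"
  by (simp add: q_def)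

lemma power_q_minus_1: "x \<noteq> 0 \<Longrightarrow> x ^ (q - 1) = x ^ q / (x::'a)"
  using q_pos by (simp add: power_diff)

lemma K_power: "x \<in> K \<Longrightarrow> x ^ i \<in> K"
  by (simp add: K_eq power_commutes) (metis power_mult mult.commute)

lemma K_mult: "x \<in> K \<Longrightarrow> y \<in> K \<Longrightarrow> x * y \<in> K"
  by (simp add: K_eq power_mult_distrib)

lemma K_divide: "x \<in> K \<Longrightarrow> y \<in> K \<Longrightarrow> x / y \<in> K"
  by (simp add: K_eq power_divide)

lemma trace_one_iff: "g \<in> trace_one q \<longleftrightarrow> g ^ q = g + (1::'a)"
  unfolding trace_one_def Tr_def mem_Collect_eq by (metis add_self_left)

lemma trace_one_nonzero: "g \<in> trace_one q \<Longrightarrow> g \<noteq> (0::'a)"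
  using q_pos by (auto simp: trace_one_iff power_0_left)

lemma trace_one_plus_iff: "h \<in> trace_one q \<Longrightarrow> h + y \<in> trace_one q \<longleftrightarrow> y \<in> K"
  by (auto simp: trace_one_iff K_eq power_q_add algebra_simps)

text \<open>A power \<open>X = x ^ q / x\<close> depends on \<open>x\<close> only up to factors from
  \<open>K\<close>. Unless \<open>X\<close> is 1, dividing \<open>x\<close> by
  \<open>x + x ^ q\<close> normalizes it to an element \<open>g\<close> of trace one, for which
  \<open>g ^ q\<close> is \<open>g + 1\<close>.\<close>

lemma nonzero_powers_eq:
  "nonzero_powers (q - 1) = insert (1::'a) ((\<lambda>g. (g + 1) / g) ` trace_one q)"
proof (intro equalityI subsetI)
  fix X :: 'a assume "X \<in> nonzero_powers (q - 1)"
  then obtain x where x: "x \<noteq> 0" "X = x ^ (q - 1)" unfolding nonzero_powers_def by auto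
  hence X: "X = x ^ q / x" using power_q_minus_1 by simp
  show "X \<in> insert 1 ((\<lambda>g. (g + 1) / g) ` trace_one q)"
  proof (cases "X = 1")
    case False
    define g where "g = x / (x + x ^ q)"
    have s: "x + x ^ q \<noteq> 0" using False x X add_eq_0_iff_eq by auto
    have "g ^ q = x ^ q / (x + x ^ q)" by (simp add: g_def power_divide power_q_add add.commute)
    moreover have "g + 1 = x ^ q / (x + x ^ q)"
      using s by (simp add: g_def divide_simps)
    ultimately have "g \<in> trace_one q" "X = (g + 1) / g"
      using s x X by (auto simp: trace_one_iff g_def)
    thus ?thesis by blast
  qed simp
next
  fix X :: 'a assume "X \<in> insert 1 ((\<lambda>g. (g + 1) / g) ` trace_one q)"
  then consider "X = 1 ^ (q - 1)" | g where "g \<in> trace_one q" "X = (g + 1) / g" by auto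
  thus "X \<in> nonzero_powers (q - 1)"
  proof cases
    case (2 g)
    hence "X = g ^ (q - 1)" "g \<noteq> 0"
      using trace_one_nonzero[of g] power_q_minus_1[of g] by (simp_all add: trace_one_iff)
    thus ?thesis by (auto simp: nonzero_powers_def)
  qed (unfold nonzero_powers_def, rule image_eqI, assumption, simp)
qed

section \<open>Roots in the special cases \<open>X = 1\<close> and \<open>k = m\<close>\<close>

lemma poly_P_poly:
  "poly (P_poly q k C) X = X ^ (2 ^ k) * X + C * X ^ (2 ^ k) + C ^ q * X + (1::'a)"
  by (simp add: P_poly_def poly_monom mult.commute)

lemma root_one_iff: "poly (P_poly q k C) 1 = 0 \<longleftrightarrow> C \<in> K"
proof -
  have "poly (P_poly q k C) 1 = C + C ^ q" by (simp add: poly_P_poly add_ac two_eq_zero)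
  thus ?thesis by (auto simp: K_eq add_eq_0_iff_eq)
qed

text \<open>In the group \<open>X ^ q = 1 / X\<close>, so for \<open>k = m\<close> the equation
  reduces to \<open>C / X + C ^ q * X = 0\<close>, that is \<open>X\<^sup>2 = C / C ^ q\<close>. A
  square root of \<open>C\<close> therefore yields a solution.\<close>

lemma root_if_k_eq_m:
  assumes "C \<notin> K"
  shows "\<exists>X\<in>nonzero_powers (q - 1). poly (P_poly q m C) X = 0"
proof -
  \<comment> \<open>Squaring is inverted by the power \<open>2 ^ (2 * m - 1)\<close>, since the
    power \<open>2 ^ (2 * m)\<close> is the identity.\<close>
  define c where "c = C ^ (2 ^ (2 * m - 1))"
  have "2 * 2 ^ (2 * m - 1) = (2::nat) ^ (2 * m)"
    using m_pos by (simp add: power_Suc[symmetric] del: power_Suc)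
  hence c: "c\<^sup>2 = C"
    by (simp add: c_def power_mult[symmetric] mult.commute[of _ 2] power_two_power_2m)
  have C0: "C \<noteq> 0" using assms q_pos by (auto simp: K_eq)
  hence c0: "c \<noteq> 0" using c by auto
  define X where "X = (1 / c) ^ (q - 1)"
  have X: "X = c / c ^ q"
    unfolding X_def using c0 by (subst power_q_minus_1) (simp_all add: power_divide)
  have Xq: "X ^ q = c ^ q / c" by (simp add: X power_divide)
  have Cq: "C ^ q = (c ^ q)\<^sup>2" by (simp add: c[symmetric] power_mult[symmetric] mult.commute)
  have "X ^ q * X + C * X ^ q + C ^ q * X + 1 = 0"
    unfolding Xq Cq unfolding X using c0
    by (simp add: c[symmetric] power2_eq_square add_ac two_eq_zero)
  hence "poly (P_poly q m C) X = 0" unfolding poly_P_poly by (simp only: q_def)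
  moreover have "X \<in> nonzero_powers (q - 1)" using c0 by (auto simp: X_def nonzero_powers_def)
  ultimately show ?thesis by blast
qed

section \<open>Reduction to an equation over \<open>K\<close>\<close>

lemma poly_P_poly_substitution:
  fixes C b h y :: 'a
  assumes b: "b \<in> K - {0}" and h: "h \<in> trace_one q" and C: "C ^ q + 1 = b * h"
    and g: "h + y \<noteq> 0"
  shows "poly (P_poly q k C) ((h + y + 1) / (h + y)) = 0 \<longleftrightarrow>
    y ^ (2 ^ k) * y + (h ^ (2 ^ k) + h + 1) * y + (h\<^sup>2 + h + 1 / b) = 0"
proof -
  define g G H Y where "g = h + y" and "G = g ^ (2 ^ k)" and "H = h ^ (2 ^ k)" and "Y = y ^ (2 ^ k)"
  have G: "G = H + Y" by (simp add: G_def g_def H_def Y_def power_two_power_add)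
  have nz: "g \<noteq> 0" "G \<noteq> 0" using assms(4) by (simp_all add: g_def G_def)
  have Cq: "C ^ q = b * h + 1" using C by (metis add_self add.assoc add_0_right)
  \<comment> \<open>The \<open>q\<close>-power map fixes \<open>b\<close> and sends \<open>h\<close>
    to \<open>h + 1\<close>, so \<open>C\<close> is read off from \<open>C ^ q\<close>.\<close>
  have "C = (C ^ q) ^ q" by simp
  also have "\<dots> = b * (h + 1) + 1"
    unfolding Cq using b h by (simp add: power_q_add power_mult_distrib K_eq trace_one_iff)
  finally have C': "C = b * (h + 1) + 1" .
  have XP: "((g + 1) / g) ^ (2 ^ k) = (G + 1) / G"
    by (simp add: power_divide power_two_power_add G_def)
  have "poly (P_poly q k C) ((g + 1) / g) * (G * g) =
      (G + 1) * (g + 1) + C * (G + 1) * g + C ^ q * G * (g + 1) + G * g"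
    unfolding poly_P_poly XP using nz by (simp add: field_simps)
  also have "\<dots> = (G + 1) * (g + 1) + (b * (h + 1) + 1) * (G + 1) * g + (b * h + 1) * G * (g + 1) + G * g"
    unfolding Cq by (subst C') simp
  \<comment> \<open>The terms without \<open>b\<close> factor as
    \<open>(G + (G + 1)) * (g + (g + 1)) = 1\<close>; this 1 is then absorbed into the bracket as
    \<open>b * (1 / b)\<close>.\<close>
  also have "\<dots> = b * (Y * y + (H + h + 1) * y + (h\<^sup>2 + h)) + 1"
    unfolding G g_def by (simp add: algebra_simps power2_eq_square two_eq_zero)
  also have "\<dots> = b * (Y * y + (H + h + 1) * y + (h\<^sup>2 + h + 1 / b))"
    using b by (simp add: algebra_simps)
  finally show ?thesis using b nz by (auto simp: g_def H_def Y_def)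
qed

lemma root_iff:
  fixes C b h :: 'a
  assumes "C \<notin> K" and b: "b \<in> K - {0}" and h: "h \<in> trace_one q" and C: "C ^ q + 1 = b * h"
  shows "(\<exists>X\<in>nonzero_powers (q - 1). poly (P_poly q k C) X = 0) \<longleftrightarrow>
    (\<exists>y\<in>K. y ^ (2 ^ k) * y + (h ^ (2 ^ k) + h + 1) * y + (h\<^sup>2 + h + 1 / b) = 0)"
proof -
  have "trace_one q = (\<lambda>y. h + y) ` K"
  proof (intro equalityI subsetI)
    fix g :: 'a assume "g \<in> trace_one q"
    hence "h + g \<in> K" using h trace_one_plus_iff[OF h, of "h + g"] by simp
    thus "g \<in> (\<lambda>y. h + y) ` K" by (auto intro: image_eqI[of _ _ "h + g"])
  qed (auto simp: trace_one_plus_iff[OF h])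
  moreover have "h + y \<noteq> 0" if "y \<in> K" for y
    using trace_one_nonzero trace_one_plus_iff[OF h] that by blast
  \<comment> \<open>The element 1 is not a root because \<open>C\<close> lies outside
    \<open>K\<close>, which leaves exactly the elements coming from some
    \<open>h + y\<close>.\<close>
  ultimately show ?thesis
    using \<open>C \<notin> K\<close> poly_P_poly_substitution[OF b h C, of _ k] unfolding nonzero_powers_eq
    by (simp add: root_one_iff)
qed

section \<open>The case \<open>t = 0\<close>\<close>

lemma iterated_Frobenius_shift:
  fixes h :: 'a
  assumes "h ^ (2 ^ i) = h + 1"
  shows "h ^ (2 ^ (i * a)) = h + of_nat a"
proof (induction a)
  case (Suc a)
  \<comment> \<open>In characteristic two \<open>of_nat a\<close> is 0 or 1, hence fixed by
    Frobenius.\<close>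
  have [simp]: "(of_nat a :: 'a) ^ (2 ^ i) = of_nat a"
    by (cases "even a") (auto elim!: evenE oddE simp: two_eq_zero)
  have "h ^ (2 ^ (i * Suc a)) = (h ^ (2 ^ (i * a))) ^ (2 ^ i)"
    by (simp add: power_mult[symmetric] power_add[symmetric] add.commute)
  also have "\<dots> = h + of_nat (Suc a)"
    by (simp add: Suc.IH power_two_power_add assms add.assoc)
  finally show ?case .
qed simp

lemma of_nat_eq_0_iff_even: "of_nat a = (0::'a) \<longleftrightarrow> even a"
  by (simp add: of_nat_eq_0_iff_char_dvd char_2[OF card_UNIV q_def])

text \<open>Take \<open>a\<close> and \<open>c\<close> to be \<open>m\<close> and \<open>k\<close>
  divided by their gcd. The same Frobenius power \<open>k * a = m * c\<close> adds both
  \<open>a\<close> and \<open>c\<close> to \<open>h\<close>, so these have equal parity; being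
  coprime, they are odd.\<close>

lemma common_multiple_odd_cofactors:
  assumes h: "h \<in> trace_one q" and t: "h ^ (2 ^ k) = h + (1::'a)"
  obtains a c where "odd a" "k * a = m * c"
proof -
  define d where "d = gcd k m"
  have d: "d > 0" using m_pos by (simp add: d_def)
  define a c where "a = m div d" and "c = k div d"
  have m: "m = d * a" and k: "k = d * c" by (simp_all add: a_def c_def d_def)
  have cop: "coprime a c"
    using m_pos unfolding a_def c_def d_def by (metis div_gcd_coprime gcd.commute not_one_le_zero)
  have eq: "k * a = m * c" by (simp add: m k)
  have "h ^ (2 ^ m) = h + 1" using h unfolding trace_one_iff by (simp only: q_def)
  from iterated_Frobenius_shift[OF this, of c] iterated_Frobenius_shift[OF t, of a]
  have "of_nat a = (of_nat c :: 'a)" by (simp add: eq)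
  hence "even a \<longleftrightarrow> even c" using of_nat_eq_0_iff_even[of a] of_nat_eq_0_iff_even[of c] by simp
  hence "odd a" using cop by (metis coprime_common_divisor odd_one)
  thus ?thesis using that eq by blast
qed

text \<open>On the finite set \<open>K\<close> injectivity suffices, and by multiplicativity only a
  trivial kernel is needed. A kernel element \<open>u\<close> is inverted by the
  \<open>2 ^ k\<close>-power, hence also by its \<open>a\<close>-fold iterate for odd
  \<open>a\<close>; but \<open>k * a = m * c\<close> makes that iterate the identity on
  \<open>K\<close>. So \<open>u * u = 1\<close>, which forces \<open>u = 1\<close> in characteristic
  two.\<close>

lemma power_surj_if_Z1:
  fixes h A :: 'a
  assumes h: "h \<in> trace_one q" and t: "h ^ (2 ^ k) = h + 1" and A: "A \<in> K"
  shows "\<exists>y\<in>K. y ^ (2 ^ k) * y = A"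
proof -
  obtain a c where a: "odd a" and ac: "k * a = m * c"
    using common_multiple_odd_cofactors[OF h t] .
  have unit: "u = 1" if u: "u \<in> K" "u ^ (2 ^ k) * u = 1" for u
  proof -
    have u0: "u \<noteq> 0" using u by auto
    have inv: "u ^ (2 ^ k) = inverse u" using u(2) by (metis inverse_unique mult.commute inverse_inverse_eq)
    have "u ^ (2 ^ (k * i)) = (if even i then u else inverse u)" for i
    proof (induction i)
      case (Suc i)
      have "u ^ (2 ^ (k * Suc i)) = (u ^ (2 ^ (k * i))) ^ (2 ^ k)"
        by (simp add: power_mult[symmetric] power_add[symmetric] add.commute)
      thus ?case by (simp add: Suc.IH inv power_inverse)
    qed simp
    from this[of a] have "u ^ (2 ^ (m * c)) = inverse u" using a ac by simp
    moreover have "u ^ (2 ^ (m * i)) = u" for i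
    proof (induction i)
      case (Suc i)
      have "u ^ (2 ^ (m * Suc i)) = (u ^ (2 ^ (m * i))) ^ (2 ^ m)"
        by (simp add: power_mult[symmetric] power_add[symmetric] add.commute)
      thus ?case using u(1) by (simp add: Suc.IH K_eq q_def)
    qed simp
    ultimately have "u * u = 1" using u0 by (metis right_inverse)
    hence "(u + 1) * (u + 1) = 0" by (simp add: algebra_simps)
    thus "u = 1" by (simp add: add_eq_0_iff_eq)
  qed
  define f where "f = (\<lambda>y::'a. y ^ (2 ^ k) * y)"
  have "inj_on f K"
  proof (rule inj_onI)
    fix x y assume x: "x \<in> K" and y: "y \<in> K" and eq: "f x = f y"
    show "x = y"
    proof (cases "y = 0")
      case False
      have "(x / y) ^ (2 ^ k) * (x / y) = 1"
        using eq False by (simp add: f_def power_divide)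
      hence "x / y = 1" using unit K_divide[OF x y] by blast
      thus ?thesis using False by simp
    qed (use eq in \<open>simp add: f_def\<close>)
  qed
  moreover have "f ` K \<subseteq> K" by (auto simp: f_def intro: K_mult K_power)
  ultimately have "f ` K = K" by (intro endo_inj_surj) auto
  then obtain y where "y \<in> K" "f y = A" using A by (metis imageE)
  thus ?thesis by (auto simp: f_def)
qed

section \<open>The case of nonzero \<open>t\<close>\<close>

lemma trinomial_root_iff:
  fixes t A :: 'a
  assumes t: "t \<in> K" "t \<noteq> 0" and k: "k \<le> 2 * m"
  shows "(\<exists>y\<in>K. y ^ (2 ^ k) * y + t * y + A = 0) \<longleftrightarrow>
    A / t ^ (2 ^ (2 * m - k) + 1) \<in> Gamma_map k ` K"
proof -
  define s where "s = t ^ (2 ^ (2 * m - k))"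
  have s0: "s \<noteq> 0" and sK: "s \<in> K" using t by (auto simp: s_def intro: K_power)
  \<comment> \<open>The exponents \<open>2 * m - k\<close> and \<open>k\<close> add up to
    \<open>2 * m\<close>; the bound on \<open>k\<close> keeps the subtraction exact.\<close>
  have ss: "s ^ (2 ^ k) = t"
    using k by (simp add: s_def power_mult[symmetric] power_add[symmetric] power_two_power_2m)
  have d: "t ^ (2 ^ (2 * m - k) + 1) = s * t" by (simp add: s_def mult.commute)
  have scale: "(s * x) ^ (2 ^ k) * (s * x) + t * (s * x) + A = 0 \<longleftrightarrow> A / (s * t) = Gamma_map k x" for x
  proof -
    have "(s * x) ^ (2 ^ k) * (s * x) + t * (s * x) = s * t * Gamma_map k x"
      by (simp add: power_mult_distrib ss Gamma_map_def algebra_simps)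
    thus ?thesis using s0 t by (auto simp: add_eq_0_iff_eq divide_simps mult_ac)
  qed
  \<comment> \<open>Multiplication by the nonzero \<open>s\<close> permutes \<open>K\<close>, so the
    quantifier may run over \<open>s * x\<close>.\<close>
  have K_scaled: "K = (\<lambda>x. s * x) ` K"
  proof (intro equalityI subsetI)
    fix y assume "y \<in> K"
    thus "y \<in> (\<lambda>x. s * x) ` K" using s0 sK by (intro image_eqI[of _ _ "y / s"]) (auto intro: K_divide)
  qed (auto intro: K_mult sK)
  have "(\<exists>y\<in>K. y ^ (2 ^ k) * y + t * y + A = 0) \<longleftrightarrow>
      (\<exists>x\<in>K. (s * x) ^ (2 ^ k) * (s * x) + t * (s * x) + A = 0)"
    by (subst (1) K_scaled) (simp only: bex_simps)
  thus ?thesis unfolding scale d by blast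
qed

section \<open>The criterion in terms of \<open>b\<close> and \<open>h\<close>\<close>

text \<open>Conjugation gives \<open>(h ^ (2 ^ i) + 1) * (h + 1)\<close>, whose leading product
  cancels in the trace. The case \<open>i = k\<close> identifies the denominator with a power of
  \<open>t\<close>, and \<open>i = 1\<close> evaluates the trace of \<open>h ^ 3\<close>.\<close>

lemma Tr_trace_one_power:
  assumes "h \<in> trace_one q"
  shows "Tr q (h ^ (2 ^ i + 1)) = h ^ (2 ^ i) + h + (1::'a)"
proof -
  have "(h ^ (2 ^ i + 1)) ^ q = (h ^ q) ^ (2 ^ i + 1)" by (rule power_power_commute)
  also have "\<dots> = (h ^ (2 ^ i) + 1) * (h + 1)"
    using assms by (simp add: trace_one_iff power_two_power_add mult.commute)
  finally show ?thesis by (simp add: Tr_def algebra_simps)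
qed

lemma no_root_iff:
  fixes C b h :: 'a
  assumes "C \<notin> K" and b: "b \<in> K - {0}" and h: "h \<in> trace_one q" and C: "C ^ q + 1 = b * h"
    and k: "k \<le> 2 * m"
  shows "\<not> (\<exists>X\<in>nonzero_powers (q - 1). poly (P_poly q k C) X = 0) \<longleftrightarrow>
    h \<notin> Z1 q k \<and>
    (Tr q (h ^ 3) + 1 + 1 / b) / Tr q (h ^ (2 ^ k + 1)) ^ (2 ^ (2 * m - k) + 1) \<notin> Gamma_map k ` K"
proof -
  define t A where "t = h ^ (2 ^ k) + h + 1" and "A = h\<^sup>2 + h + 1 / b"
  have hq: "h ^ q = h + 1" using h by (simp add: trace_one_iff)
  \<comment> \<open>The \<open>q\<close>-power map shifts \<open>h\<close> and each of these powers
    by 1, so the shifts cancel in pairs in \<open>t\<close> and in \<open>A\<close>.\<close>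
  have "(h ^ (2 ^ k)) ^ q = h ^ (2 ^ k) + 1" "(h\<^sup>2) ^ q = h\<^sup>2 + 1"
    using hq power_two_power_add[of h 1] power_two_power_add[of h 1 1]
    by (simp_all add: power_power_commute[of h _ q])
  hence tK: "t \<in> K" and AK: "A \<in> K"
    using b by (simp_all add: t_def A_def K_eq power_q_add hq power_divide add_ac)
  have t: "Tr q (h ^ (2 ^ k + 1)) = t" by (simp only: Tr_trace_one_power[OF h] t_def)
  have A: "Tr q (h ^ 3) + 1 + 1 / b = A"
    using Tr_trace_one_power[OF h, of 1]
    by (simp add: A_def add_ac numeral_3_eq_3 power2_eq_square)
  have Z: "h \<in> Z1 q k \<longleftrightarrow> t = 0" using h by (simp add: Z1_def t_def add_eq_0_iff_eq)
  show ?thesis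
  proof (cases "t = 0")
    case True
    \<comment> \<open>Here \<open>h\<close> lies in \<open>Z1 q k\<close>, so the right-hand side
      fails and a root has to be produced.\<close>
    hence "h ^ (2 ^ k) = h + 1" by (simp add: t_def add.assoc add_eq_0_iff_eq)
    from power_surj_if_Z1[OF h this AK] obtain y where "y \<in> K" "y ^ (2 ^ k) * y = A" by blast
    hence "\<exists>y\<in>K. y ^ (2 ^ k) * y + t * y + A = 0" using True by (intro bexI[of _ y]) simp_all
    thus ?thesis unfolding root_iff[OF assms(1-4)] Z t A using True by (simp add: t_def A_def)
  next
    case False
    show ?thesis
      unfolding root_iff[OF assms(1-4)] Z t A
      using trinomial_root_iff[OF tK False k, of A] False by (simp add: t_def A_def)
  qed
qed

end

theorem theorem9:
  fixes C :: "'a::finite_field" and K :: "'a set" and m n q k :: nat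
  assumes "m \<ge> 1" and "n = 2 * m" and "q = 2 ^ m"
    and "CARD('a) = q\<^sup>2"
    and "is_subfield K" and "card K = q"
    and "1 \<le> k" and "k < n"
  shows "\<not> (\<exists>X\<in>nonzero_powers (q - 1). poly (P_poly q k C) X = 0) \<longleftrightarrow>
    k \<noteq> m \<and>
    C \<notin> K \<and>
    (\<exists>b\<in>K - {0}. \<exists>h\<in>trace_one q. C ^ q + 1 = b * h \<and>
       h \<notin> Z1 q k \<and>
       (Tr q (h ^ 3) + 1 + 1 / b) / Tr q (h ^ (2 ^ k + 1)) ^ (2 ^ (n - k) + 1) \<notin> Gamma_map k ` K)"
proof -
  have "K = {x. x ^ q = x}"
    using is_subfield_card_iff[OF assms(4,3,1)] assms(5,6) by blast
  then interpret binary_quadratic_extension K m q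
    using assms(1,3,4) by unfold_locales
  have k: "k \<le> 2 * m" using assms by simp
  show ?thesis
  proof (cases "C \<in> K")
    case True
    have "(1::'a) \<in> nonzero_powers (q - 1)" unfolding nonzero_powers_eq by (rule insertI1)
    moreover have "poly (P_poly q k C) 1 = 0" using True by (simp only: root_one_iff)
    ultimately have "\<exists>X\<in>nonzero_powers (q - 1). poly (P_poly q k C) X = 0" by (rule bexI[rotated])
    thus ?thesis using True by simp
  next
    case False
    let ?no_root = "\<not> (\<exists>X\<in>nonzero_powers (q - 1). poly (P_poly q k C) X = 0)"
    let ?cond = "\<lambda>b h. h \<notin> Z1 q k \<and>
      (Tr q (h ^ 3) + 1 + 1 / b) / Tr q (h ^ (2 ^ k + 1)) ^ (2 ^ (n - k) + 1) \<notin> Gamma_map k ` K"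
    \<comment> \<open>The equivalence holds for every admissible pair: one fixed representation
      gives the forward direction, and any witness gives the converse.\<close>
    have iff: "?no_root \<longleftrightarrow> ?cond b h"
      if "b \<in> K - {0}" "h \<in> trace_one q" "C ^ q + 1 = b * h" for b h
      unfolding assms(2) by (rule no_root_iff[OF False that k])
    obtain b h where bh: "b \<in> K - {0}" "h \<in> trace_one q" "C ^ q + 1 = b * h"
      using unique_representation[OF assms(4,3,1,5,6) False] by auto
    have "?no_root \<longleftrightarrow> (\<exists>b\<in>K - {0}. \<exists>h\<in>trace_one q. C ^ q + 1 = b * h \<and> ?cond b h)"
    proof
      assume ?no_root
      thus "\<exists>b\<in>K - {0}. \<exists>h\<in>trace_one q. C ^ q + 1 = b * h \<and> ?cond b h"
        using bh iff[OF bh] by blast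
    next
      assume "\<exists>b\<in>K - {0}. \<exists>h\<in>trace_one q. C ^ q + 1 = b * h \<and> ?cond b h"
      thus ?no_root using iff by meson
    qed
    moreover have "?no_root \<Longrightarrow> k \<noteq> m" using root_if_k_eq_m[OF False] by blast
    ultimately show ?thesis using False by argo
  qed
qed

end
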